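(* Let $\alpha\in\mathbb{R}_{>0}$ be an algebraic number with primitive integer minimal polynomial $\mathfrak{m}_\alpha(X)\in\mathbb{Z}[X]$, and write $\mathfrak{m}_\alpha(X)=p_\alpha(X)-q_\alpha(X)$, where $(p_\alpha,q_\alpha)$ is the canonical minimal pair of $\mathfrak{m}_\alpha$. Suppose that $q_\alpha(X)=c$ is a constant with $c\in\mathbb{N}$. Then: \begin{enumerate} \item If $p_\alpha(X)=X^m$ for some $m\in\mathbb{N}$, then $\mathbb{N}_0[\alpha]$ is a UFM. \item Otherwise (that is, if $p_\alpha(X)$ is not of the form $X^m$): \begin{itemize} \item[(i)] if $c=1$, then $\mathbb{N}_0[\alpha]$ is antimatter; \item[(ii)] if $c>1$, then $\mathbb{N}_0[\alpha]$ is atomic and is infinitely generated. \end{itemize} \end{enumerate}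
   Context: $\mathbb{N}=\{1,2,3,\dots\}$ and $\mathbb{N}_0=\mathbb{N}\cup\{0\}$. For $\alpha\in\mathbb{R}_{>0}$, $\mathbb{N}_0[\alpha]=\{f(\alpha): f(X)\in\mathbb{N}_0[X]\}\subseteq\mathbb{R}_{\ge 0}$, viewed as a commutative cancellative monoid under addition. For $\alpha$ algebraic over $\mathbb{Q}$, $\mathfrak{m}_\alpha(X)\in\mathbb{Z}[X]$ is the unique primitive integer polynomial (gcd of coefficients equal to $1$) with positive leading coefficient that is a rational multiple of the minimal polynomial of $\alpha$ over $\mathbb{Q}$. For $f(X)=\sum_i a_iX^i\in\mathbb{Z}[X]$, the canonical minimal pair of $f$ is $(f^+,f^-)$ with $f^+(X)=\sum_{a_i>0}a_iX^i$ and $f^-(X)=\sum_{a_i<0}(-a_i)X^i$; thus $f=f^+-f^-$ and $f^+,f^-\in\mathbb{N}_0[X]$ have disjoint supports. Here $(p_\alpha,q_\alpha)=(\mathfrak{m}_\alpha^+,\mathfrak{m}_\alpha^-)$. For a commutative cancellative monoid $(M,+,0)$: a unit is an element with an additive inverse in $M$; a nonunit $a\in M\setminus\{0\}$ is an atom if $a=b+c$ with $b,c\in M$ implies that $b$ or $c$ is a unit; $M$ is atomic if every nonzero nonunit is a finite sum of atoms, and antimatter if it has no atoms. If $M$ is atomic, a factorization of $x\in M\setminus\{0\}$ is an expression $x=a_1+\cdots+a_k$ with $k\in\mathbb{N}$ and all $a_i$ atoms, considered up to permutation of the atoms; $M$ is a UFM (unique factorization monoid) if it is atomic and every $x\neq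 0$ has exactly one factorization. $M$ is finitely generated if there is a finite subset $S\subseteq M$ such that every element of $M$ is a finite (possibly empty) sum of elements of $S$; infinitely generated means not finitely generated. *)

theory Defs
  imports
    Complex_Main
    "HOL-Computational_Algebra.Polynomial"
    "HOL-Algebra.Divisibility"
begin

section \<open>Primitive integer minimal polynomials\<close>

definition rat_min_poly :: "real \<Rightarrow> rat poly" where
  "rat_min_poly \<alpha> = (THE p. lead_coeff p = 1 \<and> poly (map_poly of_rat p) \<alpha> = 0 \<and>
     (\<forall>q. q \<noteq> 0 \<and> poly (map_poly of_rat q) \<alpha> = 0 \<longrightarrow> degree p \<le> degree q))"

definition int_min_poly :: "real \<Rightarrow> int poly" where
  "int_min_poly \<alpha> = (THE f. content f = 1 \<and> lead_coeff f > 0 \<and>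
     (\<exists>r. map_poly of_int f = smult r (rat_min_poly \<alpha>)))"

text \<open>Both descriptions above are uniquely satisfied when \<open>\<alpha>\<close> is algebraic.\<close>

lemma rat_min_poly_ex1:
  assumes "algebraic \<alpha>"
  shows "\<exists>!p. lead_coeff p = (1::rat) \<and> poly (map_poly of_rat p) \<alpha> = (0::real) \<and>
     (\<forall>q::rat poly. q \<noteq> 0 \<and> poly (map_poly of_rat q) \<alpha> = 0 \<longrightarrow> degree p \<le> degree q)"
proof -
  define ev where "ev = (\<lambda>q::rat poly. poly (map_poly of_rat q) \<alpha>)"
  have ev_eq: "poly (map_poly of_rat q) \<alpha> = ev q" for q
    by (simp add: ev_def)
  have ev_diff: "ev (p - q) = ev p - ev q" for p q
  proof -
    have "map_poly of_rat (p - q) = map_poly of_rat p - (map_poly of_rat q :: real poly)"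
      by (rule poly_eqI) (simp add: coeff_map_poly of_rat_diff)
    then show ?thesis by (simp add: ev_def)
  qed
  have ev_smult: "ev (smult r p) = of_rat r * ev p" for r p
  proof -
    have "map_poly of_rat (smult r p) = smult (of_rat r) (map_poly of_rat p :: real poly)"
      by (rule poly_eqI) (simp add: coeff_map_poly of_rat_mult)
    then show ?thesis by (simp add: ev_def)
  qed
  obtain P where P: "\<forall>i. coeff P i \<in> \<int>" "P \<noteq> 0" "poly P \<alpha> = 0"
    using assms unfolding algebraic_def by blast
  define Q where "Q = map_poly (\<lambda>x. rat_of_int \<lfloor>x\<rfloor>) P"
  have QP: "map_poly of_rat Q = P"
  proof (rule poly_eqI)
    fix i
    show "coeff (map_poly of_rat Q) i = coeff P i"
      using P(1)[rule_format, of i] by (auto simp: Q_def coeff_map_poly elim: Ints_cases)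
  qed
  have Q: "Q \<noteq> 0 \<and> ev Q = 0" using P QP by (auto simp: ev_def)
  define d where "d = (LEAST n. \<exists>q. q \<noteq> 0 \<and> ev q = 0 \<and> degree q = n)"
  have "\<exists>q. q \<noteq> 0 \<and> ev q = 0 \<and> degree q = d"
    unfolding d_def by (rule LeastI_ex) (use Q in blast)
  then obtain p0 where p0: "p0 \<noteq> 0" "ev p0 = 0" "degree p0 = d" by blast
  have least: "d \<le> degree q" if "q \<noteq> 0" "ev q = 0" for q
    unfolding d_def by (rule Least_le) (use that in blast)
  define p where "p = smult (inverse (lead_coeff p0)) p0"
  have p: "lead_coeff p = 1" "ev p = 0" "degree p = d"
    using p0 by (auto simp: p_def ev_smult)
  show ?thesis
    unfolding ev_eq
  proof (rule ex1I[of _ p])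
    show "lead_coeff p = 1 \<and> ev p = 0 \<and> (\<forall>q. q \<noteq> 0 \<and> ev q = 0 \<longrightarrow> degree p \<le> degree q)"
      using p least by auto
  next
    fix q
    assume q: "lead_coeff q = 1 \<and> ev q = 0 \<and> (\<forall>r. r \<noteq> 0 \<and> ev r = 0 \<longrightarrow> degree q \<le> degree r)"
    have "q \<noteq> 0" using q by auto
    then have dq: "degree q = d"
      using q least[of q] p0 by force
    show "q = p"
    proof (rule ccontr)
      assume "q \<noteq> p"
      then have ne: "q - p \<noteq> 0" by simp
      have "d \<le> degree (q - p)" using ne q p by (intro least) (auto simp: ev_diff)
      moreover have "degree (q - p) \<le> d" using dq p degree_diff_le[of q d p] by simp
      ultimately have "degree (q - p) = d" by simp
      then have "lead_coeff (q - p) = 0" using q p dq by simp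
      then have "q - p = 0" by (simp only: leading_coeff_0_iff)
      with ne show False ..
    qed
  qed
qed

lemma int_min_poly_ex1:
  assumes "algebraic \<alpha>"
  shows "\<exists>!f. content f = (1::int) \<and> lead_coeff f > 0 \<and>
     (\<exists>r::rat. map_poly of_int f = smult r (rat_min_poly \<alpha>))"
proof -
  define P where "P = rat_min_poly \<alpha>"
  have lP: "lead_coeff P = 1"
    using theI'[OF rat_min_poly_ex1[OF assms]] unfolding P_def rat_min_poly_def by blast
  define den where "den = (\<lambda>i. snd (quotient_of (coeff P i)))"
  define D where "D = (\<Prod>i\<le>degree P. den i)"
  have den_pos: "den i > 0" for i
    by (simp add: den_def quotient_of_denom_pos')
  have D_pos: "D > 0" unfolding D_def by (rule prod_pos) (simp add: den_pos)
  have integral: "of_int \<lfloor>of_int D * coeff P i\<rfloor> = of_int D * coeff P i" for i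
  proof (cases "i \<le> degree P")
    case True
    then have "den i dvd D" unfolding D_def by (intro dvd_prodI) auto
    then obtain k where k: "D = den i * k" by (elim dvdE)
    have "coeff P i = of_int (fst (quotient_of (coeff P i))) / of_int (den i)"
      unfolding den_def by (rule quotient_of_div) simp
    then have "of_int D * coeff P i = of_int (k * fst (quotient_of (coeff P i)))"
      using den_pos[of i] by (simp add: k field_simps)
    then show ?thesis by simp
  next
    case False
    then show ?thesis by (simp add: coeff_eq_0)
  qed
  define g where "g = map_poly (\<lambda>x. \<lfloor>of_int D * x\<rfloor>) P"
  have cg: "rat_of_int (coeff g i) = of_int D * coeff P i" for i
    by (simp add: g_def coeff_map_poly integral)
  define f where "f = primitive_part g"
  have g_pos: "lead_coeff g > 0" and "g \<noteq> 0"
  proof -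
    have "coeff g i = 0 \<longleftrightarrow> coeff P i = 0" for i
      using cg[of i] D_pos by (metis mult_eq_0_iff of_int_eq_0_iff less_irrefl)
    then have "degree g = degree P" by (simp add: degree_def)
    then have "rat_of_int (lead_coeff g) = of_int D" using cg[of "degree P"] lP by simp
    then show "lead_coeff g > 0" using D_pos by simp
    then show "g \<noteq> 0" by auto
  qed
  have gf: "g = smult (content g) f" by (simp add: f_def)
  have cont_pos: "content g > 0"
    using \<open>g \<noteq> 0\<close> normalize_content[of g] by (metis abs_ge_zero content_eq_zero_iff normalize_int_def order_le_less)
  have f1: "content f = 1" using \<open>g \<noteq> 0\<close> by (simp add: f_def)
  have "lead_coeff g = content g * lead_coeff f"
    using gf by (metis lead_coeff_smult)
  then have f2: "lead_coeff f > 0" using g_pos cont_pos by (simp add: zero_less_mult_iff)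
  have f3: "map_poly of_int f = smult (of_int D / of_int (content g)) P"
  proof (rule poly_eqI)
    fix i
    have "coeff g i = content g * coeff f i" using gf by (metis coeff_smult)
    then have "of_int (content g) * rat_of_int (coeff f i) = of_int D * coeff P i"
      using cg[of i] by simp
    then show "coeff (map_poly of_int f) i = coeff (smult (of_int D / rat_of_int (content g)) P) i"
      using \<open>g \<noteq> 0\<close> by (simp add: coeff_map_poly field_simps)
  qed
  show ?thesis
    unfolding P_def[symmetric]
  proof (rule ex1I[of _ f])
    show "content f = 1 \<and> lead_coeff f > 0 \<and> (\<exists>r. map_poly of_int f = smult r P)"
      using f1 f2 f3 by blast
  next
    fix h
    assume h: "content h = 1 \<and> lead_coeff h > 0 \<and> (\<exists>r. map_poly of_int h = smult r P)"
    then obtain r where r: "map_poly rat_of_int h = smult r P" by blast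
    from f3 obtain s where s: "map_poly rat_of_int f = smult s P" by blast
    have ch: "rat_of_int (coeff h i) = r * coeff P i" for i
      using arg_cong[OF r, of "\<lambda>q. coeff q i"] by (simp add: coeff_map_poly)
    have cf: "rat_of_int (coeff f i) = s * coeff P i" for i
      using arg_cong[OF s, of "\<lambda>q. coeff q i"] by (simp add: coeff_map_poly)
    have "rat_of_int (coeff h (degree f) * coeff f i) = of_int (coeff h i * coeff f (degree f))" for i
      by (simp add: ch cf)
    moreover have deg: "degree h = degree f"
    proof -
      have "r \<noteq> 0" using h ch[of "degree h"] by auto
      moreover have "s \<noteq> 0" using f2 cf[of "degree f"] by auto
      ultimately have "coeff h i = 0 \<longleftrightarrow> coeff f i = 0" for i
        using ch[of i] cf[of i] by (metis mult_eq_0_iff of_int_eq_0_iff)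
      then show ?thesis by (simp add: degree_def)
    qed
    ultimately have "lead_coeff h * coeff f i = lead_coeff f * coeff h i" for i
      by (metis mult.commute of_int_eq_iff)
    then have eq: "smult (lead_coeff h) f = smult (lead_coeff f) h"
      by (intro poly_eqI) simp
    from arg_cong[OF this, of content] have "lead_coeff h = lead_coeff f"
      using h f1 f2 by simp
    with eq have "smult (lead_coeff f) f = smult (lead_coeff f) h" by simp
    moreover have "lead_coeff f \<noteq> 0" using f2 by linarith
    ultimately show "h = f" by (metis smult_cancel)
  qed
qed


section \<open>Canonical minimal pairs\<close>

definition canonical_minimal_pair :: "int poly \<Rightarrow> nat poly \<times> nat poly" where
  "canonical_minimal_pair f =
     (\<Sum>i\<in>{i. coeff f i > 0}. monom (nat (coeff f i)) i,
      \<Sum>i\<in>{i. coeff f i < 0}. monom (nat (- coeff f i)) i)"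

text \<open>The index sets are finite, so the sums have their intended values.\<close>

lemma coeff_canonical_minimal_pair:
  "coeff (fst (canonical_minimal_pair f)) i = nat (coeff f i)"
  "coeff (snd (canonical_minimal_pair f)) i = nat (- coeff f i)"
proof -
  have fin: "finite {i. coeff f i > 0}" "finite {i. coeff f i < 0}"
    by (rule finite_subset[of _ "{..degree f}"]; force intro: le_degree)+
  show "coeff (fst (canonical_minimal_pair f)) i = nat (coeff f i)"
    using fin by (auto simp: canonical_minimal_pair_def coeff_sum sum.delta)
  show "coeff (snd (canonical_minimal_pair f)) i = nat (- coeff f i)"
    using fin by (auto simp: canonical_minimal_pair_def coeff_sum sum.delta)
qed

lemma canonical_minimal_pair_diff:
  "f = map_poly of_nat (fst (canonical_minimal_pair f)) -
       map_poly of_nat (snd (canonical_minimal_pair f))"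
  by (rule poly_eqI) (simp add: coeff_map_poly coeff_canonical_minimal_pair)


section \<open>Atoms and factorizations in commutative cancellative monoids\<close>

definition atom :: "('a, 'b) monoid_scheme \<Rightarrow> 'a \<Rightarrow> bool" where
  "atom G a \<longleftrightarrow> a \<in> carrier G \<and> a \<noteq> \<one>\<^bsub>G\<^esub> \<and> a \<notin> Units G \<and>
     (\<forall>b\<in>carrier G. \<forall>c\<in>carrier G. a = b \<otimes>\<^bsub>G\<^esub> c \<longrightarrow> b \<in> Units G \<or> c \<in> Units G)"

definition atomic_monoid :: "('a, 'b) monoid_scheme \<Rightarrow> bool" where
  "atomic_monoid G \<longleftrightarrow> (\<forall>x\<in>carrier G. x \<noteq> \<one>\<^bsub>G\<^esub> \<and> x \<notin> Units G \<longrightarrow>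
     (\<exists>fs. (\<forall>a\<in>set fs. atom G a) \<and> foldr (\<otimes>\<^bsub>G\<^esub>) fs \<one>\<^bsub>G\<^esub> = x))"

definition antimatter_monoid :: "('a, 'b) monoid_scheme \<Rightarrow> bool" where
  "antimatter_monoid G \<longleftrightarrow> \<not> (\<exists>a. atom G a)"

text \<open>A factorization up to permutation is the multiset underlying a list of atoms.\<close>

definition factorizations :: "('a, 'b) monoid_scheme \<Rightarrow> 'a \<Rightarrow> 'a multiset set" where
  "factorizations G x = {mset fs |fs. fs \<noteq> [] \<and> (\<forall>a\<in>set fs. atom G a) \<and>
     foldr (\<otimes>\<^bsub>G\<^esub>) fs \<one>\<^bsub>G\<^esub> = x}"

definition unique_factorization_monoid :: "('a, 'b) monoid_scheme \<Rightarrow> bool" where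
  "unique_factorization_monoid G \<longleftrightarrow> atomic_monoid G \<and>
     (\<forall>x\<in>carrier G. x \<noteq> \<one>\<^bsub>G\<^esub> \<longrightarrow> (\<exists>!A. A \<in> factorizations G x))"

definition finitely_generated_monoid :: "('a, 'b) monoid_scheme \<Rightarrow> bool" where
  "finitely_generated_monoid G \<longleftrightarrow> (\<exists>S. finite S \<and> S \<subseteq> carrier G \<and>
     (\<forall>x\<in>carrier G. \<exists>xs. set xs \<subseteq> S \<and> foldr (\<otimes>\<^bsub>G\<^esub>) xs \<one>\<^bsub>G\<^esub> = x))"

lemma (in comm_monoid_cancel) atom_iff_irreducible:
  "atom G a \<longleftrightarrow> a \<in> carrier G \<and> Divisibility.irreducible G a"
proof
  assume a: "atom G a"
  then have aG: "a \<in> carrier G" by (simp add: atom_def)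
  moreover have "Divisibility.irreducible G a"
  proof (rule irreducibleI)
    show "a \<notin> Units G" using a by (simp add: atom_def)
  next
    fix b
    assume b: "b \<in> carrier G" "properfactor G b a"
    then obtain c where c: "c \<in> carrier G" "a = b \<otimes> c"
      by (auto simp: properfactor_def factor_def)
    have "c \<notin> Units G"
    proof
      assume "c \<in> Units G"
      then have "b = a \<otimes> inv c" "inv c \<in> carrier G"
        using b c by (auto simp: m_assoc)
      then have "a divides b" by (auto simp: factor_def)
      with b show False by (simp add: properfactor_def)
    qed
    with a b c show "b \<in> Units G" by (auto simp: atom_def)
  qed
  ultimately show "a \<in> carrier G \<and> Divisibility.irreducible G a" ..
next
  assume a: "a \<in> carrier G \<and> Divisibility.irreducible G a"
  then have nu: "a \<notin> Units G" by (simp add: Divisibility.irreducible_def)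
  have "b \<in> Units G \<or> c \<in> Units G" if bc: "b \<in> carrier G" "c \<in> carrier G" "a = b \<otimes> c" for b c
  proof (rule disjCI)
    assume c: "c \<notin> Units G"
    have "\<not> a divides b"
    proof
      assume "a divides b"
      then obtain d where d: "d \<in> carrier G" "b = (b \<otimes> c) \<otimes> d"
        using bc by (auto simp: factor_def)
      have "b \<otimes> (c \<otimes> d) = (b \<otimes> c) \<otimes> d" using bc d(1) by (simp add: m_assoc)
      also have "\<dots> = b" by (rule d(2)[symmetric])
      also have "b = b \<otimes> \<one>" using bc by simp
      finally have "c \<otimes> d = \<one>" by (rule l_cancel) (use bc d(1) in auto)
      moreover have "d \<otimes> c = c \<otimes> d" using bc d(1) by (simp add: m_comm)
      ultimately have "c \<in> Units G" using bc d(1) by (auto simp: Units_def)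
      with c show False ..
    qed
    then have "properfactor G b a" using bc by (auto simp: properfactor_def factor_def)
    then show "b \<in> Units G" using a bc by (auto simp: Divisibility.irreducible_def)
  qed
  then show "atom G a" using a nu by (auto simp: atom_def)
qed

lemma (in comm_monoid_cancel) unique_factorization_iff_factorial:
  assumes red: "Units G = {\<one>}"
  shows "unique_factorization_monoid G \<longleftrightarrow> factorial_monoid G"
proof -
  have atoms: "(\<forall>a\<in>set fs. atom G a) \<and> foldr (\<otimes>) fs \<one> = x \<longleftrightarrow>
      set fs \<subseteq> carrier G \<and> factors G fs x" for fs x
    by (auto simp: factors_def atom_iff_irreducible)
  have assoc_eq: "a = b" if ab: "a \<sim> b" "a \<in> carrier G" "b \<in> carrier G" for a b
  proof -
    obtain u where "a = b \<otimes> u" "u \<in> Units G"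
      using associatedD2[OF ab] by blast
    then show ?thesis using red ab by simp
  qed
  have list_assoc_eq: "as = bs"
    if "list_all2 (\<sim>) as bs" "set as \<subseteq> carrier G" "set bs \<subseteq> carrier G" for as bs
    using that by (induction rule: list_all2_induct) (auto intro: assoc_eq)
  have ee: "essentially_equal G fs gs \<longleftrightarrow> mset fs = mset gs"
    if "set fs \<subseteq> carrier G" "set gs \<subseteq> carrier G" for fs gs
  proof
    assume "essentially_equal G fs gs"
    then obtain fs' where fs': "mset fs = mset fs'" "list_all2 (\<sim>) fs' gs"
      by (auto simp: essentially_equal_def)
    then have "set fs' \<subseteq> carrier G" using that by (metis mset_eq_setD)
    with fs' that show "mset fs = mset gs" using list_assoc_eq by blast
  next
    assume "mset fs = mset gs"
    moreover have "list_all2 (\<sim>) gs gs"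
      using that by (auto intro!: list.rel_refl_strong)
    ultimately show "essentially_equal G fs gs" by (auto simp: essentially_equal_def)
  qed
  have Z: "A \<in> factorizations G x \<longleftrightarrow> (\<exists>fs. A = mset fs \<and> set fs \<subseteq> carrier G \<and> factors G fs x)"
    if "x \<noteq> \<one>" for A x
  proof -
    have "fs \<noteq> []" if "factors G fs x" for fs
      using that \<open>x \<noteq> \<one>\<close> by (auto simp: factors_def)
    then show ?thesis by (auto simp: factorizations_def atoms)
  qed
  show ?thesis
  proof
    assume u: "unique_factorization_monoid G"
    show "factorial_monoid G"
    proof unfold_locales
      fix a assume "a \<in> carrier G" "a \<notin> Units G"
      then show "\<exists>fs. set fs \<subseteq> carrier G \<and> factors G fs a"
        using u red by (auto simp: unique_factorization_monoid_def atomic_monoid_def atoms)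
    next
      fix fs fs' a
      assume *: "factors G fs a" "factors G fs' a" "a \<in> carrier G" "a \<notin> Units G"
        "set fs \<subseteq> carrier G" "set fs' \<subseteq> carrier G"
      then have "a \<noteq> \<one>" using red by simp
      then have "mset fs \<in> factorizations G a" "mset fs' \<in> factorizations G a"
        using * Z by blast+
      then have "mset fs = mset fs'"
        using u * \<open>a \<noteq> \<one>\<close> unfolding unique_factorization_monoid_def by blast
      then show "essentially_equal G fs fs'" using * ee by blast
    qed
  next
    assume "factorial_monoid G"
    then interpret F: factorial_monoid G .
    have ex: "\<exists>fs. set fs \<subseteq> carrier G \<and> factors G fs x" if "x \<in> carrier G" "x \<noteq> \<one>" for x
      using F.factors_exist[of x] that red by auto
    have "atomic_monoid G"
      using ex by (auto simp: atomic_monoid_def atoms)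
    moreover have "\<exists>!A. A \<in> factorizations G x" if x: "x \<in> carrier G" "x \<noteq> \<one>" for x
    proof -
      have "mset fs = mset gs" if "set fs \<subseteq> carrier G" "factors G fs x"
        "set gs \<subseteq> carrier G" "factors G gs x" for fs gs
        using F.factors_unique[of fs x gs] that x red ee by auto
      then show ?thesis using ex[OF x] by (auto simp: Z[OF x(2)])
    qed
    ultimately show "unique_factorization_monoid G"
      by (simp add: unique_factorization_monoid_def)
  qed
qed


section \<open>The monoid of nonnegative integer polynomial values\<close>

text \<open>The additive monoid is encoded multiplicatively: \<open>\<otimes>\<close> is addition and \<open>\<one>\<close> is \<open>0\<close>.\<close>

definition N0_monoid :: "real \<Rightarrow> real monoid" where
  "N0_monoid \<alpha> =
     \<lparr>carrier = {poly (map_poly of_nat f) \<alpha> |f :: nat poly. True}, mult = (+), one = 0\<rparr>"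

lemma N0_monoid_comm_monoid_cancel: "comm_monoid_cancel (N0_monoid \<alpha>)"
proof -
  have "\<exists>h::nat poly. poly (map_poly of_nat f) \<alpha> + poly (map_poly of_nat g) \<alpha> = poly (map_poly of_nat h) \<alpha>"
    for f g :: "nat poly"
  proof -
    have "map_poly of_nat (f + g) = map_poly of_nat f + (map_poly of_nat g :: real poly)"
      by (rule poly_eqI) (simp add: coeff_map_poly)
    then show ?thesis by (metis poly_add)
  qed
  moreover have "\<exists>f::nat poly. 0 = poly (map_poly of_nat f) \<alpha>"
    by (rule exI[of _ 0]) simp
  ultimately show ?thesis
    by (intro comm_monoid_cancelI comm_monoidI) (auto simp: N0_monoid_def)
qed

end

theory Submission
  imports Defs
begin

text \<open>
  Elements of \<open>\<nat>\<^sub>0[\<alpha>]\<close> are sums of powers of \<open>\<alpha>\<close> over multisets of exponents, so every atom is a power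
  of \<open>\<alpha>\<close>. If \<open>p = X\<^sup>m\<close>, the exponents can be reduced below \<open>m\<close>, and then the multiset is unique
  because \<open>1, \<alpha>, \<dots>, \<alpha>\<^sup>m\<^sup>-\<^sup>1\<close> are linearly independent. If \<open>c = 1\<close> and \<open>p\<close> is not a power of \<open>X\<close>, then
  \<open>1 = p(\<alpha>)\<close> splits \<open>\<alpha>\<^sup>n\<close> into at least two powers. If \<open>c > 1\<close> and \<open>\<alpha>\<^sup>n = f(\<alpha>)\<close> with \<open>f \<noteq> X\<^sup>n\<close> in \<open>\<nat>\<^sub>0[X]\<close>,
  Gauss's lemma gives \<open>f - X\<^sup>n = (p - c) g\<close> with \<open>g\<close> integral. Comparing coefficients from the bottom
  shows that all coefficients of \<open>g\<close> are at most \<open>0\<close>. Then \<open>(p - c) g\<close> has a negative coefficient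
  at \<open>deg g + i\<close> for each \<open>i\<close> in the support of \<open>p\<close>, and only \<open>deg g + i = n\<close> is possible, so \<open>p\<close> is a power
  of \<open>X\<close>. Otherwise, therefore, all powers of \<open>\<alpha>\<close> are distinct atoms.
\<close>

section \<open>Integer polynomials vanishing at an algebraic number\<close>

lemma map_poly_of_int_diff:
  "map_poly of_int (f - g) = map_poly of_int f - (map_poly of_int g :: 'a::comm_ring_1 poly)"
  by (rule poly_eqI) (simp add: coeff_map_poly)

lemma map_poly_of_int_smult:
  "map_poly of_int (smult a f) = smult (of_int a) (map_poly of_int f :: 'a::comm_ring_1 poly)"
  by (rule poly_eqI) (simp add: coeff_map_poly)

lemma map_poly_of_int_mult:
  "map_poly of_int (f * g) = map_poly of_int f * (map_poly of_int g :: 'a::comm_ring_1 poly)"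
  by (rule poly_eqI) (simp add: coeff_map_poly coeff_mult)

text \<open>The definite descriptions are unfolded once here: a rational scalar multiple keeps the
  root and does not raise the degree, so minimality over the rationals carries over to integer
  polynomials.\<close>

lemma
  assumes "algebraic \<alpha>"
  shows content_int_min_poly: "content (int_min_poly \<alpha>) = 1"
    and poly_int_min_poly: "poly (map_poly of_int (int_min_poly \<alpha>)) \<alpha> = 0"
    and degree_int_min_poly_le:
      "h \<noteq> 0 \<Longrightarrow> poly (map_poly of_int h) \<alpha> = 0 \<Longrightarrow> degree (int_min_poly \<alpha>) \<le> degree h"
proof -
  define P where "P = rat_min_poly \<alpha>"
  have P: "lead_coeff P = 1" "poly (map_poly of_rat P) \<alpha> = 0"
    "\<And>q. q \<noteq> 0 \<Longrightarrow> poly (map_poly of_rat q) \<alpha> = 0 \<Longrightarrow> degree P \<le> degree q"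
    using theI'[OF rat_min_poly_ex1[OF assms]] unfolding P_def rat_min_poly_def by blast+
  define M where "M = int_min_poly \<alpha>"
  have M: "content M = 1" "lead_coeff M > 0" "\<exists>r. map_poly of_int M = smult r P"
    using theI'[OF int_min_poly_ex1[OF assms]] unfolding M_def P_def int_min_poly_def by blast+
  then obtain r where r: "map_poly of_int M = smult r P" by blast
  have conv: "map_poly of_rat (map_poly rat_of_int h) = (map_poly of_int h :: real poly)" for h
    by (rule poly_eqI) (simp add: coeff_map_poly)
  have deg: "degree (map_poly rat_of_int h) = degree h" for h
    by (rule degree_map_poly) simp
  show "content (int_min_poly \<alpha>) = 1" using M M_def by simp
  have "map_poly of_int M = (smult (of_rat r) (map_poly of_rat P) :: real poly)"
    unfolding conv[symmetric] r by (rule poly_eqI) (simp add: coeff_map_poly of_rat_mult)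
  then show "poly (map_poly of_int (int_min_poly \<alpha>)) \<alpha> = 0"
    using P M_def by simp
  assume h: "h \<noteq> 0" "poly (map_poly of_int h) \<alpha> = 0"
  have "degree M \<le> degree P"
    using deg[of M] r degree_smult_le by metis
  also have "degree P \<le> degree (map_poly rat_of_int h)"
    using h by (intro P(3)) (auto simp: conv poly_eq_iff coeff_map_poly)
  finally show "degree (int_min_poly \<alpha>) \<le> degree h" using deg M_def by simp
qed

text \<open>The pseudo-remainder vanishes at \<alpha> and has smaller degree than the minimal
  polynomial, hence is zero; it remains to cancel the scalar \<open>a\<close> over the
  integers.\<close>

lemma int_min_poly_dvd:
  assumes "algebraic \<alpha>" "poly (map_poly of_int h) \<alpha> = 0"
  shows "int_min_poly \<alpha> dvd h"
proof -
  define M where "M = int_min_poly \<alpha>"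
  note M = content_int_min_poly[OF assms(1), folded M_def] poly_int_min_poly[OF assms(1), folded M_def]
    degree_int_min_poly_le[OF assms(1), folded M_def]
  have "M \<noteq> 0" using M(1) by auto
  then obtain a q where a: "a \<noteq> 0" and eq: "smult a h = M * q + pseudo_mod h M"
    using pseudo_mod(1) by blast
  have "pseudo_mod h M = smult a h - M * q" using eq by simp
  then have "poly (map_poly of_int (pseudo_mod h M)) \<alpha> = 0"
    using assms(2) M(2)
    by (simp add: map_poly_of_int_diff map_poly_of_int_smult map_poly_of_int_mult)
  then have "pseudo_mod h M = 0"
    using pseudo_mod(2)[OF \<open>M \<noteq> 0\<close>, of h] M(3) by fastforce
  with eq have eq: "smult a h = M * q" by simp
  \<comment> \<open>Gauss's lemma: content is multiplicative and \<open>M\<close> is primitive, so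
    \<open>a\<close> divides every coefficient of \<open>q\<close>.\<close>
  from arg_cong[OF eq, of content] have "content q = normalize a * content h"
    using M(1) by (simp add: content_mult)
  then have "a dvd content q" by simp
  then have "[:a:] dvd q" by (simp add: const_poly_dvd_iff_dvd_content)
  then obtain q' where "q = [:a:] * q'" by (rule dvdE)
  with eq have "smult a h = smult a (M * q')" by simp
  then have "h = M * q'" using a smult_cancel by blast
  then show ?thesis by (simp add: M_def)
qed

text \<open>Meant for \<open>M\<close> of the form \<open>p - c\<close> with \<open>c > 1\<close>
  and for \<open>M * g\<close> of the form \<open>f - X^n\<close>. The lowest coefficient of
  \<open>M\<close> controls the signs in \<open>g\<close>; the top coefficient of \<open>g\<close>
  then produces a negative coefficient for each positive exponent of \<open>M\<close>.\<close>

lemma factor_with_one_negative_coeff: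
  fixes M g :: "int poly"
  assumes M0: "coeff M 0 \<le> -2" and M: "\<And>i. 0 < i \<Longrightarrow> 0 \<le> coeff M i"
    and nonneg: "\<And>j. j \<noteq> n \<Longrightarrow> 0 \<le> coeff (M * g) j" and n: "-1 \<le> coeff (M * g) n"
    and "g \<noteq> 0" and i: "0 < i" "coeff M i \<noteq> 0"
  shows "coeff M i = 1" "degree g + i = n"
proof -
  have g: "coeff g j \<le> 0" for j
  proof (induction j rule: less_induct)
    case (less j)
    have "coeff (M * g) j = coeff M 0 * coeff g j + (\<Sum>k\<in>{..j} - {0}. coeff M k * coeff g (j - k))"
      unfolding coeff_mult by (subst sum.remove[of _ 0]) auto
    also have "(\<Sum>k\<in>{..j} - {0}. coeff M k * coeff g (j - k)) \<le> 0"
      by (intro sum_nonpos mult_nonneg_nonpos M less) auto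
    finally have "-1 \<le> coeff M 0 * coeff g j"
      using nonneg[of j] n by (cases "j = n") auto
    show ?case
    proof (rule ccontr)
      \<comment> \<open>Here \<open>coeff M 0 \<le> -2\<close> is decisive:
        \<open>coeff g j \<ge> 1\<close> would push the product down to -2, below the permitted
        -1.\<close>
      assume "\<not> coeff g j \<le> 0"
      then have "coeff M 0 * coeff g j \<le> (-2) * coeff g j"
        using M0 by (intro mult_right_mono) auto
      with \<open>-1 \<le> coeff M 0 * coeff g j\<close> \<open>\<not> coeff g j \<le> 0\<close> show False by linarith
    qed
  qed
  let ?e = "degree g"
  have lead: "lead_coeff g \<le> -1"
    using g[of ?e] leading_coeff_neq_0[OF \<open>g \<noteq> 0\<close>] by linarith
  have "coeff (M * g) (?e + i) =
      coeff M i * coeff g ?e + (\<Sum>k\<in>{..?e + i} - {i}. coeff M k * coeff g (?e + i - k))"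
    unfolding coeff_mult by (subst sum.remove[of _ i]) auto
  also have "(\<Sum>k\<in>{..?e + i} - {i}. coeff M k * coeff g (?e + i - k)) \<le> 0"
  proof (rule sum_nonpos)
    \<comment> \<open>At \<open>k = 0\<close> the sign is unfavourable, but the index
      \<open>degree g + i\<close> lies beyond the degree of \<open>g\<close>, so that term is
      zero.\<close>
    fix k
    show "coeff M k * coeff g (?e + i - k) \<le> 0"
      using i M[of k] g[of "?e + i - k"]
      by (cases "k = 0") (auto simp: coeff_eq_0 intro: mult_nonneg_nonpos)
  qed
  finally have "coeff (M * g) (?e + i) \<le> coeff M i * lead_coeff g" by simp
  also have "\<dots> \<le> coeff M i * (-1)"
    using M[OF i(1)] lead by (intro mult_left_mono)
  finally have *: "coeff (M * g) (?e + i) \<le> - coeff M i" by simp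
  \<comment> \<open>The coefficient of the product is thus at most -1, which only position
    \<open>n\<close> admits, and the bound there leaves exactly -1.\<close>
  have "coeff M i \<ge> 1" using M[OF i(1)] i by linarith
  then show "?e + i = n" using * nonneg[of "?e + i"] by force
  then show "coeff M i = 1" using * n \<open>coeff M i \<ge> 1\<close> by auto
qed


section \<open>Sums of powers\<close>

lemma coeff_sum_mset_monom:
  "coeff (\<Sum>i\<in>#M. monom (1::'a::comm_semiring_1) i) j = of_nat (count M j)"
  by (induction M) (auto simp: algebra_simps)

lemma map_poly_of_int_sum_mset_monom:
  "map_poly of_int (\<Sum>i\<in>#M. monom 1 i) = (\<Sum>i\<in>#M. monom (1::'a::comm_ring_1) i)"
  by (rule poly_eqI) (simp add: coeff_map_poly coeff_sum_mset_monom)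

lemma poly_sum_mset_monom:
  "poly (\<Sum>i\<in>#M. monom (1::'a::comm_semiring_1) i) x = (\<Sum>i\<in>#M. x ^ i)"
  by (induction M) (auto simp: poly_monom)

text \<open>Finite support makes the coefficient function a multiset, so a polynomial over the
  naturals can be traded for its multiset of exponents.\<close>

lemma ex_mset_count_coeff: "\<exists>M. \<forall>i. count M i = coeff f i"
proof
  have "finite {i. 0 < coeff f i}"
    by (rule finite_subset[of _ "{..degree f}"]) (auto intro: le_degree)
  then show "\<forall>i. count (Abs_multiset (coeff f)) i = coeff f i"
    by simp
qed

lemma nat_poly_as_sum_mset:
  assumes "\<And>i. count M i = coeff f i"
  shows "map_poly of_nat f = (\<Sum>i\<in>#M. monom (1::'a::comm_semiring_1) i)"
  by (rule poly_eqI) (simp add: coeff_map_poly coeff_sum_mset_monom assms)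

lemma carrier_N0_monoid: "carrier (N0_monoid \<alpha>) = range (\<lambda>M. \<Sum>i\<in>#M. \<alpha> ^ i)"
proof safe
  fix x assume "x \<in> carrier (N0_monoid \<alpha>)"
  then obtain f :: "nat poly" where "x = poly (map_poly of_nat f) \<alpha>"
    by (auto simp: N0_monoid_def)
  moreover obtain M where M: "\<And>i. count M i = coeff f i" using ex_mset_count_coeff by blast
  ultimately have "x = (\<Sum>i\<in>#M. \<alpha> ^ i)"
    by (simp add: nat_poly_as_sum_mset[OF M] poly_sum_mset_monom)
  then show "x \<in> range (\<lambda>M. \<Sum>i\<in>#M. \<alpha> ^ i)" by blast
next
  fix M :: "nat multiset"
  have "map_poly of_nat (\<Sum>i\<in>#M. monom 1 i) = (\<Sum>i\<in>#M. monom (1::real) i)"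
    by (rule nat_poly_as_sum_mset) (simp add: coeff_sum_mset_monom del: One_nat_def)
  then have "(\<Sum>i\<in>#M. \<alpha> ^ i) = poly (map_poly of_nat (\<Sum>i\<in>#M. monom 1 i)) \<alpha>"
    by (simp add: poly_sum_mset_monom)
  then show "(\<Sum>i\<in>#M. \<alpha> ^ i) \<in> carrier (N0_monoid \<alpha>)"
    by (auto simp: N0_monoid_def)
qed

lemma mult_N0_monoid [simp]: "x \<otimes>\<^bsub>N0_monoid \<alpha>\<^esub> y = x + y"
  and one_N0_monoid [simp]: "\<one>\<^bsub>N0_monoid \<alpha>\<^esub> = 0"
  by (simp_all add: N0_monoid_def)

lemma foldr_mult_N0_monoid [simp]:
  "foldr (\<otimes>\<^bsub>N0_monoid \<alpha>\<^esub>) xs \<one>\<^bsub>N0_monoid \<alpha>\<^esub> = sum_list xs"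
  by (induction xs) auto

lemma sum_powers_in_N0_monoid: "(\<Sum>i\<in>#M. \<alpha> ^ i) \<in> carrier (N0_monoid \<alpha>)"
  by (simp add: carrier_N0_monoid)

lemma power_in_N0_monoid: "\<alpha> ^ i \<in> carrier (N0_monoid \<alpha>)"
  using sum_powers_in_N0_monoid[of \<alpha> "{#i#}"] by simp

lemma sum_powers_eq_0_iff:
  fixes \<alpha> :: real
  assumes "\<alpha> > 0"
  shows "(\<Sum>i\<in>#M. \<alpha> ^ i) = 0 \<longleftrightarrow> M = {#}"
proof -
  have "(\<Sum>i\<in>#M. \<alpha> ^ i) > 0" if "M \<noteq> {#}"
    using that
  proof (induction M)
    case (add i M)
    then show ?case using assms by (cases "M = {#}") (auto intro: add_pos_pos)
  qed simp
  then show ?thesis by (cases "M = {#}") force+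
qed

lemma N0_monoid_nonneg:
  assumes "\<alpha> > 0" "x \<in> carrier (N0_monoid \<alpha>)"
  shows "0 \<le> x"
proof -
  have "0 \<le> (\<Sum>i\<in>#M. \<alpha> ^ i)" for M
    using assms(1) by (induction M) auto
  then show ?thesis using assms(2) by (auto simp: carrier_N0_monoid)
qed

lemma Units_N0_monoid:
  assumes "\<alpha> > 0"
  shows "Units (N0_monoid \<alpha>) = {0}"
proof -
  interpret comm_monoid_cancel "N0_monoid \<alpha>" by (rule N0_monoid_comm_monoid_cancel)
  have "0 \<in> Units (N0_monoid \<alpha>)" using Units_one_closed by simp
  moreover have "x = 0" if x: "x \<in> Units (N0_monoid \<alpha>)" for x
  proof -
    from x obtain y where "x \<in> carrier (N0_monoid \<alpha>)" "y \<in> carrier (N0_monoid \<alpha>)" "x + y = 0"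
      by (auto simp: Units_def)
    then show ?thesis using N0_monoid_nonneg[OF assms] by (metis add_nonneg_eq_0_iff)
  qed
  ultimately show ?thesis by blast
qed

lemma atom_N0_monoid_iff:
  assumes "\<alpha> > 0"
  shows "atom (N0_monoid \<alpha>) a \<longleftrightarrow> a \<in> carrier (N0_monoid \<alpha>) \<and> a \<noteq> 0 \<and>
    (\<forall>b\<in>carrier (N0_monoid \<alpha>). \<forall>c\<in>carrier (N0_monoid \<alpha>). a = b + c \<longrightarrow> b = 0 \<or> c = 0)"
  unfolding atom_def Units_N0_monoid[OF assms] mult_N0_monoid one_N0_monoid by blast

text \<open>Splitting off the head leaves either a zero head or a zero tail. This shows both that
  atoms are powers of \<alpha> and that every generating set contains all atoms.\<close>

lemma atom_in_summands:
  assumes "\<alpha> > 0" "atom (N0_monoid \<alpha>) (sum_list xs)" "set xs \<subseteq> carrier (N0_monoid \<alpha>)"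
  shows "sum_list xs \<in> set xs"
  using assms(2,3)
proof (induction xs)
  case Nil
  then show ?case by (simp add: atom_def)
next
  case (Cons x xs)
  interpret comm_monoid_cancel "N0_monoid \<alpha>" by (rule N0_monoid_comm_monoid_cancel)
  have "sum_list xs \<in> carrier (N0_monoid \<alpha>)"
    using Cons.prems(2) by (induction xs) (use m_closed one_closed in auto)
  then have "x = 0 \<or> sum_list xs = 0"
    using Cons.prems unfolding atom_N0_monoid_iff[OF assms(1)] by simp
  then show ?case using Cons by auto
qed

lemma atom_eq_power:
  assumes "\<alpha> > 0" "atom (N0_monoid \<alpha>) (\<Sum>i\<in>#M. \<alpha> ^ i)"
  shows "\<exists>n\<in>#M. (\<Sum>i\<in>#M. \<alpha> ^ i) = \<alpha> ^ n"
proof -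
  obtain ns where ns: "mset ns = M" using ex_mset by blast
  then have eq: "sum_list (map (power \<alpha>) ns) = (\<Sum>i\<in>#M. \<alpha> ^ i)"
    by (metis mset_map sum_mset_sum_list)
  have "sum_list (map (power \<alpha>) ns) \<in> set (map (power \<alpha>) ns)"
    using assms eq by (intro atom_in_summands[of \<alpha>]) (auto simp: power_in_N0_monoid)
  then show ?thesis using ns eq by auto
qed


section \<open>Atoms and factorizations in \<open>\<nat>\<^sub>0[\<alpha>]\<close>\<close>

lemma N0_monoid_antimatter:
  assumes \<alpha>: "\<alpha> > 0" and P: "(\<Sum>i\<in>#P. \<alpha> ^ i) = 1" "size P \<noteq> 1"
  shows "antimatter_monoid (N0_monoid \<alpha>)"
  unfolding antimatter_monoid_def
proof safe
  fix a assume a: "atom (N0_monoid \<alpha>) a"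
  then obtain M where "a = (\<Sum>i\<in>#M. \<alpha> ^ i)"
    by (auto simp: atom_def carrier_N0_monoid)
  with a atom_eq_power[OF \<alpha>] obtain n where n: "a = \<alpha> ^ n" by blast
  \<comment> \<open>A sum equal to 1 is not empty, and size other than 1 leaves \<open>Q\<close>
    nonempty, so both parts of the splitting below are positive.\<close>
  obtain k Q where Q: "P = add_mset k Q" using P(1) by (cases P) auto
  have "Q \<noteq> {#}" using P(2) Q by auto
  have "a = \<alpha> ^ n * (\<Sum>i\<in>#P. \<alpha> ^ i)" using P n by simp
  also have "\<dots> = \<alpha> ^ (n + k) + (\<Sum>i\<in>#image_mset ((+) n) Q. \<alpha> ^ i)"
    by (simp add: Q distrib_left power_add sum_mset_distrib_left image_mset.compositionality o_def)
  finally have "\<alpha> ^ (n + k) = 0 \<or> (\<Sum>i\<in>#image_mset ((+) n) Q. \<alpha> ^ i) = 0"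
    using a power_in_N0_monoid sum_powers_in_N0_monoid unfolding atom_N0_monoid_iff[OF \<alpha>] by blast
  then show False
    using \<alpha> \<open>Q \<noteq> {#}\<close> by (simp only: sum_powers_eq_0_iff[OF \<alpha>]) simp
qed

text \<open>Multisets over \<open>E\<close> act as normal forms: a splitting of \<alpha>^n becomes
  \<open>B + C = {#n#}\<close>, so one part is empty. The parameter \<open>E\<close> covers both the
  exponents below \<open>m\<close> and all exponents.\<close>

lemma atom_powerI:
  assumes \<alpha>: "\<alpha> > 0"
    and span: "\<And>N. \<exists>M. set_mset M \<subseteq> E \<and> (\<Sum>i\<in>#N. \<alpha> ^ i) = (\<Sum>i\<in>#M. \<alpha> ^ i)"
    and uniq: "\<And>M. set_mset M \<subseteq> E \<Longrightarrow> (\<Sum>i\<in>#M. \<alpha> ^ i) = \<alpha> ^ n \<Longrightarrow> M = {#n#}"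
  shows "atom (N0_monoid \<alpha>) (\<alpha> ^ n)"
  unfolding atom_N0_monoid_iff[OF \<alpha>]
proof (intro conjI ballI impI)
  fix b c assume bc: "b \<in> carrier (N0_monoid \<alpha>)" "c \<in> carrier (N0_monoid \<alpha>)" "\<alpha> ^ n = b + c"
  from bc span obtain B C where BC: "set_mset B \<subseteq> E" "set_mset C \<subseteq> E"
    "b = (\<Sum>i\<in>#B. \<alpha> ^ i)" "c = (\<Sum>i\<in>#C. \<alpha> ^ i)"
    unfolding carrier_N0_monoid by (metis imageE)
  then have "B + C = {#n#}" using bc(3) by (intro uniq) auto
  then show "b = 0 \<or> c = 0" using BC by (auto simp: union_is_single)
qed (use \<alpha> power_in_N0_monoid in auto)

lemma N0_monoid_atomic:
  assumes span: "\<And>N. \<exists>M. set_mset M \<subseteq> E \<and> (\<Sum>i\<in>#N. \<alpha> ^ i) = (\<Sum>i\<in>#M. \<alpha> ^ i)"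
    and atoms: "\<And>n. n \<in> E \<Longrightarrow> atom (N0_monoid \<alpha>) (\<alpha> ^ n)"
  shows "atomic_monoid (N0_monoid \<alpha>)"
  unfolding atomic_monoid_def foldr_mult_N0_monoid
proof (intro ballI impI)
  fix x assume "x \<in> carrier (N0_monoid \<alpha>)"
  with span obtain M where M: "set_mset M \<subseteq> E" "x = (\<Sum>i\<in>#M. \<alpha> ^ i)"
    unfolding carrier_N0_monoid by (metis imageE)
  obtain ns where ns: "mset ns = M" using ex_mset by blast
  then have "sum_list (map (power \<alpha>) ns) = x"
    using M by (metis mset_map sum_mset_sum_list)
  moreover have "\<forall>a\<in>set (map (power \<alpha>) ns). atom (N0_monoid \<alpha>) a"
    using ns M atoms by auto
  ultimately show "\<exists>fs. (\<forall>a\<in>set fs. atom (N0_monoid \<alpha>) a) \<and> sum_list fs = x" by blast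
qed

text \<open>The hypotheses say that the monoid is free on the powers with exponent in
  \<open>E\<close>; its atoms are exactly these powers.\<close>

lemma N0_monoid_unique_factorization:
  assumes \<alpha>: "\<alpha> > 0"
    and span: "\<And>N. \<exists>M. set_mset M \<subseteq> E \<and> (\<Sum>i\<in>#N. \<alpha> ^ i) = (\<Sum>i\<in>#M. \<alpha> ^ i)"
    and uniq: "\<And>M N. set_mset M \<subseteq> E \<Longrightarrow> set_mset N \<subseteq> E \<Longrightarrow>
      (\<Sum>i\<in>#M. \<alpha> ^ i) = (\<Sum>i\<in>#N. \<alpha> ^ i) \<Longrightarrow> M = N"
  shows "unique_factorization_monoid (N0_monoid \<alpha>)"
proof -
  have atoms: "atom (N0_monoid \<alpha>) (\<alpha> ^ n)" if "n \<in> E" for n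
    using \<alpha> span by (rule atom_powerI) (use uniq[of _ "{#n#}"] that in auto)
  have atomic: "atomic_monoid (N0_monoid \<alpha>)"
    using span atoms by (rule N0_monoid_atomic)
  have powers: "a \<in> power \<alpha> ` E" if "atom (N0_monoid \<alpha>) a" for a
  proof -
    have "a \<in> carrier (N0_monoid \<alpha>)" using that by (simp add: atom_def)
    with span obtain M where M: "set_mset M \<subseteq> E" "a = (\<Sum>i\<in>#M. \<alpha> ^ i)"
      unfolding carrier_N0_monoid by (metis imageE)
    then show ?thesis using atom_eq_power[OF \<alpha>] that by blast
  qed
  \<comment> \<open>A factorization is lifted to a multiset of exponents, where \<open>uniq\<close>
    can compare two of them.\<close>
  have fact: "\<exists>M. A = image_mset (power \<alpha>) M \<and> set_mset M \<subseteq> E \<and> (\<Sum>i\<in>#M. \<alpha> ^ i) = x"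
    if A: "A \<in> factorizations (N0_monoid \<alpha>) x" for A x
  proof -
    from A obtain fs where fs: "A = mset fs" "\<forall>a\<in>set fs. atom (N0_monoid \<alpha>) a" "sum_list fs = x"
      unfolding factorizations_def foldr_mult_N0_monoid by blast
    then have "fs \<in> lists (power \<alpha> ` E)" using powers by auto
    then obtain ns where "fs = map (power \<alpha>) ns" "set ns \<subseteq> E"
      unfolding lists_image by auto
    with fs show ?thesis
      by (intro exI[of _ "mset ns"]) (auto simp: sum_mset_sum_list simp flip: mset_map)
  qed
  show ?thesis
    unfolding unique_factorization_monoid_def
  proof (intro conjI ballI impI atomic ex_ex1I)
    fix x assume x: "x \<in> carrier (N0_monoid \<alpha>)" "x \<noteq> \<one>\<^bsub>N0_monoid \<alpha>\<^esub>"
    then obtain fs where fs: "\<forall>a\<in>set fs. atom (N0_monoid \<alpha>) a" "sum_list fs = x"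
      using atomic Units_N0_monoid[OF \<alpha>]
      unfolding atomic_monoid_def foldr_mult_N0_monoid by force
    then have "fs \<noteq> []" using x by auto
    then show "\<exists>A. A \<in> factorizations (N0_monoid \<alpha>) x"
      unfolding factorizations_def foldr_mult_N0_monoid using fs by blast
  next
    fix x A B
    assume "A \<in> factorizations (N0_monoid \<alpha>) x" "B \<in> factorizations (N0_monoid \<alpha>) x"
    then show "A = B" using fact uniq by metis
  qed
qed

text \<open>A generating set must contain every atom, and the powers of \<alpha> are infinitely many
  atoms.\<close>

lemma N0_monoid_not_finitely_generated:
  assumes \<alpha>: "\<alpha> > 0" and "inj (power \<alpha>)" and atoms: "\<And>n. atom (N0_monoid \<alpha>) (\<alpha> ^ n)"
  shows "\<not> finitely_generated_monoid (N0_monoid \<alpha>)"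
proof
  assume "finitely_generated_monoid (N0_monoid \<alpha>)"
  then obtain S where S: "finite S" "S \<subseteq> carrier (N0_monoid \<alpha>)"
    "\<And>x. x \<in> carrier (N0_monoid \<alpha>) \<Longrightarrow> \<exists>xs. set xs \<subseteq> S \<and> sum_list xs = x"
    unfolding finitely_generated_monoid_def foldr_mult_N0_monoid by blast
  have "\<alpha> ^ n \<in> S" for n
  proof -
    obtain xs where xs: "set xs \<subseteq> S" "sum_list xs = \<alpha> ^ n"
      using S(3)[OF power_in_N0_monoid] by blast
    then show ?thesis using atom_in_summands[OF \<alpha>, of xs] atoms[of n] S(2) by auto
  qed
  then have "finite (range (power \<alpha>))"
    using S(1) by (meson finite_subset image_subsetI)
  then show False using \<open>inj (power \<alpha>)\<close> finite_imageD infinite_UNIV_nat by blast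
qed

section \<open>Relations between powers of \<alpha>\<close>

lemma sum_powers_reduce_exponents:
  fixes \<alpha> :: real
  assumes "\<alpha> ^ m = of_nat c" "m \<ge> 1"
  shows "\<exists>M. set_mset M \<subseteq> {..<m} \<and> (\<Sum>i\<in>#N. \<alpha> ^ i) = (\<Sum>i\<in>#M. \<alpha> ^ i)"
proof (induction N)
  case empty
  then show ?case by (intro exI[of _ "{#}"]) auto
next
  case (add n N)
  then obtain M where M: "set_mset M \<subseteq> {..<m}" "(\<Sum>i\<in>#N. \<alpha> ^ i) = (\<Sum>i\<in>#M. \<alpha> ^ i)" by blast
  \<comment> \<open>Division of \<open>n\<close> by \<open>m\<close> turns \<alpha>^n into
    \<open>c ^ (n div m)\<close> copies of the power with exponent \<open>n mod m\<close>.\<close>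
  have "\<alpha> ^ n = (\<alpha> ^ m) ^ (n div m) * \<alpha> ^ (n mod m)"
    by (simp flip: power_mult power_add)
  also have "\<dots> = (\<Sum>i\<in>#replicate_mset (c ^ (n div m)) (n mod m). \<alpha> ^ i)"
    by (simp add: assms)
  finally show ?case
    using M assms(2) by (intro exI[of _ "replicate_mset (c ^ (n div m)) (n mod m) + M"]) auto
qed

text \<open>This is linear independence of the powers below the degree: a nonzero difference
  \<open>h\<close> would vanish at \<alpha> with too small a degree.\<close>

lemma sum_powers_unique_below_degree:
  assumes "algebraic \<alpha>"
    and "set_mset M \<subseteq> {..<degree (int_min_poly \<alpha>)}" "set_mset N \<subseteq> {..<degree (int_min_poly \<alpha>)}"
    and "(\<Sum>i\<in>#M. \<alpha> ^ i) = (\<Sum>i\<in>#N. \<alpha> ^ i)"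
  shows "M = N"
proof (rule ccontr)
  define h where "h = (\<Sum>i\<in>#M. monom 1 i) - (\<Sum>i\<in>#N. monom (1::int) i)"
  have h: "coeff h j = int (count M j) - int (count N j)" for j
    by (simp add: h_def coeff_sum_mset_monom)
  assume "M \<noteq> N"
  then obtain j where "count M j \<noteq> count N j" by (auto simp: multiset_eq_iff)
  then have "coeff h j \<noteq> 0" by (simp add: h)
  then have "h \<noteq> 0" by auto
  have "poly (map_poly of_int h) \<alpha> = 0"
    using assms(4)
    by (simp add: h_def map_poly_of_int_diff map_poly_of_int_sum_mset_monom poly_sum_mset_monom)
  then have "degree (int_min_poly \<alpha>) \<le> degree h"
    using degree_int_min_poly_le assms(1) \<open>h \<noteq> 0\<close> by blast
  then have "degree h \<notin># M" "degree h \<notin># N" using assms(2,3) by force+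
  then have "lead_coeff h = 0" by (simp add: h not_in_iff)
  with \<open>h \<noteq> 0\<close> show False by simp
qed

text \<open>A second representation of \<alpha>^n gives a nonzero multiple of the minimal polynomial
  whose only possible negative coefficient is -1 at \<open>n\<close>. The hypothesis
  \<open>not_binomial\<close> excludes the shape \<open>X^m - c\<close>.\<close>

lemma sum_powers_eq_power:
  assumes "algebraic \<alpha>"
    and M0: "coeff (int_min_poly \<alpha>) 0 \<le> -2" and M: "\<And>i. 0 < i \<Longrightarrow> 0 \<le> coeff (int_min_poly \<alpha>) i"
    and not_binomial: "\<And>m. 0 < m \<Longrightarrow> \<exists>i>0. coeff (int_min_poly \<alpha>) i \<noteq> (if i = m then 1 else 0)"
    and eq: "(\<Sum>i\<in>#N. \<alpha> ^ i) = \<alpha> ^ n"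
  shows "N = {#n#}"
proof (rule ccontr)
  assume "N \<noteq> {#n#}"
  define h where "h = (\<Sum>i\<in>#N. monom 1 i) - monom (1::int) n"
  have h: "coeff h j = int (count N j) - (if j = n then 1 else 0)" for j
    by (simp add: h_def coeff_sum_mset_monom)
  obtain j where "count N j \<noteq> count {#n#} j" using \<open>N \<noteq> {#n#}\<close> by (auto simp: multiset_eq_iff)
  then have "coeff h j \<noteq> 0" by (auto simp: h split: if_splits)
  then have "h \<noteq> 0" by auto
  have "poly (map_poly of_int h) \<alpha> = 0"
    using eq
    by (simp add: h_def map_poly_of_int_diff map_poly_of_int_sum_mset_monom poly_sum_mset_monom
        map_poly_monom poly_monom)
  then obtain g where g: "h = int_min_poly \<alpha> * g"
    using int_min_poly_dvd[OF assms(1)] by (auto elim: dvdE)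
  \<comment> \<open>Every positive exponent in the support equals \<open>n - degree g\<close>, so
    there is only one, namely the degree.\<close>
  have supp: "coeff (int_min_poly \<alpha>) i = 1 \<and> degree g + i = n"
    if "0 < i" "coeff (int_min_poly \<alpha>) i \<noteq> 0" for i
    using factor_with_one_negative_coeff[of "int_min_poly \<alpha>" n g i] that M0 M \<open>h \<noteq> 0\<close> h
    unfolding g by fastforce
  have "int_min_poly \<alpha> \<noteq> 0" using M0 by auto
  have deg_pos: "degree (int_min_poly \<alpha>) > 0"
  proof (rule ccontr)
    assume "\<not> degree (int_min_poly \<alpha>) > 0"
    then obtain a where "int_min_poly \<alpha> = [:a:]" by (auto elim: degree_eq_zeroE)
    then show False
      using poly_int_min_poly[OF assms(1)] \<open>int_min_poly \<alpha> \<noteq> 0\<close> by (simp add: map_poly_pCons)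
  qed
  have "lead_coeff (int_min_poly \<alpha>) \<noteq> 0" using \<open>int_min_poly \<alpha> \<noteq> 0\<close> by simp
  with deg_pos have deg: "degree g + degree (int_min_poly \<alpha>) = n" "lead_coeff (int_min_poly \<alpha>) = 1"
    using supp by blast+
  obtain i where i: "i > 0"
    "coeff (int_min_poly \<alpha>) i \<noteq> (if i = degree (int_min_poly \<alpha>) then 1 else 0)"
    using not_binomial[OF deg_pos] by blast
  show False
  proof (cases "i = degree (int_min_poly \<alpha>)")
    case True
    then show False using i deg by simp
  next
    case False
    then have "coeff (int_min_poly \<alpha>) i \<noteq> 0" using i by simp
    then show False using supp[OF i(1)] deg False by simp
  qed
qed

theorem theorem10:
  fixes \<alpha> :: real and p q :: "nat poly" and c :: nat
  assumes "\<alpha> > 0"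
    and "algebraic \<alpha>"
    and "(p, q) = canonical_minimal_pair (int_min_poly \<alpha>)"
    and "c \<ge> 1"
    and "q = [:c:]"
  shows "((\<exists>m\<ge>1. p = monom 1 m) \<longrightarrow> unique_factorization_monoid (N0_monoid \<alpha>)) \<and>
    (\<not> (\<exists>m\<ge>1. p = monom 1 m) \<longrightarrow>
      (c = 1 \<longrightarrow> antimatter_monoid (N0_monoid \<alpha>)) \<and>
      (c > 1 \<longrightarrow> atomic_monoid (N0_monoid \<alpha>) \<and> \<not> finitely_generated_monoid (N0_monoid \<alpha>)))"
proof -
  define M where "M = int_min_poly \<alpha>"
  have pq: "p = fst (canonical_minimal_pair M)" "q = snd (canonical_minimal_pair M)"
    using assms(3) by (metis M_def fst_conv, metis M_def snd_conv)
  have coeff_p: "coeff p i = nat (coeff M i)" for i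
    by (simp add: pq coeff_canonical_minimal_pair)
  have coeff_q: "nat (- coeff M i) = coeff [:c:] i" for i
    using assms(5) pq by (metis coeff_canonical_minimal_pair(2))
  have M0: "coeff M 0 = - int c" using coeff_q[of 0] assms(4) by simp
  have M_nonneg: "0 \<le> coeff M i" if "0 < i" for i
    using coeff_q[of i] that by (cases i) auto
  have p0: "coeff p 0 = 0" using M0 by (simp add: coeff_p)
  \<comment> \<open>\<open>P\<close> is the multiset of exponents of \<open>p\<close>; thus
    \<open>p = X^m\<close> exactly when \<open>P\<close> is the singleton of
    \<open>m\<close>.\<close>
  obtain P where P: "\<And>i. count P i = coeff p i" using ex_mset_count_coeff by blast
  have M_eq: "M = (\<Sum>i\<in>#P. monom 1 i) - [:int c:]"
  proof (rule poly_eqI)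
    fix i
    show "coeff M i = coeff ((\<Sum>i\<in>#P. monom 1 i) - [:int c:]) i"
      using M0 M_nonneg[of i] by (cases i) (auto simp: coeff_sum_mset_monom P coeff_p)
  qed
  have "poly (map_poly of_int M) \<alpha> = 0"
    unfolding M_def by (rule poly_int_min_poly[OF assms(2)])
  then have P_sum: "(\<Sum>i\<in>#P. \<alpha> ^ i) = real c"
    by (simp add: M_eq map_poly_of_int_diff map_poly_of_int_sum_mset_monom poly_sum_mset_monom
        map_poly_pCons)
  have monom: "p = monom 1 m \<longleftrightarrow> P = {#m#}" for m
    by (auto simp: multiset_eq_iff P poly_eq_iff)
  have P_pos: "m \<ge> 1" if "P = {#m#}" for m
    using p0 P[of 0] that by (cases m) auto
  show ?thesis
  proof (intro conjI impI)
    assume "\<exists>m\<ge>1. p = monom 1 m"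
    then obtain m where m: "m \<ge> 1" "P = {#m#}" using monom by blast
    then have "\<alpha> ^ m = real c" using P_sum by simp
    \<comment> \<open>This puts \<open>m\<close> at or below the degree, so exponents less than
      \<open>m\<close> fall in the range of linear independence.\<close>
    have "coeff M m = 1" using m by (simp add: M_eq coeff_pCons split: nat.split)
    then have "m \<le> degree (int_min_poly \<alpha>)" unfolding M_def[symmetric] by (intro le_degree) simp
    then show "unique_factorization_monoid (N0_monoid \<alpha>)"
      by (intro N0_monoid_unique_factorization[OF assms(1), of "{..<m}"]
          sum_powers_reduce_exponents[OF \<open>\<alpha> ^ m = real c\<close> m(1)]
          sum_powers_unique_below_degree[OF assms(2)]) auto
  next
    assume no: "\<not> (\<exists>m\<ge>1. p = monom 1 m)" and "c = 1"
    \<comment> \<open>A single exponent would make \<open>p\<close> a monomial, with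
      \<open>m \<ge> 1\<close> because \<open>p\<close> has zero constant term.\<close>
    have "size P \<noteq> 1"
      using no monom P_pos size_1_singleton_mset by blast
    then show "antimatter_monoid (N0_monoid \<alpha>)"
      using N0_monoid_antimatter[OF assms(1)] P_sum \<open>c = 1\<close> by simp
  next
    assume no: "\<not> (\<exists>m\<ge>1. p = monom 1 m)" and "c > 1"
    have not_binomial: "\<exists>i>0. coeff M i \<noteq> (if i = m then 1 else 0)" if "0 < m" for m
    proof (rule ccontr)
      assume "\<not> ?thesis"
      then have binomial: "coeff M i = (if i = m then 1 else 0)" if "0 < i" for i
        using that by blast
      have "coeff p i = coeff (monom 1 m) i" for i
        using binomial[of i] p0 \<open>0 < m\<close> by (cases "i = 0") (auto simp: coeff_p)
      then show False using no \<open>0 < m\<close> by (metis One_nat_def Suc_leI poly_eqI)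
    qed
    have uniq: "N = {#n#}" if "(\<Sum>i\<in>#N. \<alpha> ^ i) = \<alpha> ^ n" for N n
      using assms(2) _ _ not_binomial[unfolded M_def] that
      by (rule sum_powers_eq_power) (use M0 M_nonneg \<open>c > 1\<close> in \<open>auto simp: M_def\<close>)
    \<comment> \<open>With all exponents allowed, each sum of powers represents itself, and
      \<open>uniq\<close> alone makes every power an atom.\<close>
    have atoms: "atom (N0_monoid \<alpha>) (\<alpha> ^ n)" for n
      by (rule atom_powerI[OF assms(1), of UNIV]) (auto intro: uniq)
    show "atomic_monoid (N0_monoid \<alpha>)"
      by (rule N0_monoid_atomic[of UNIV]) (auto intro: atoms)
    have "inj (power \<alpha>)"
    proof (rule injI)
      fix k n assume "\<alpha> ^ k = \<alpha> ^ n"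
      then show "k = n" using uniq[of "{#k#}" n] by simp
    qed
    then show "\<not> finitely_generated_monoid (N0_monoid \<alpha>)"
      using assms(1) atoms by (intro N0_monoid_not_finitely_generated)
  qed
qed

end
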